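(* Let $p\in S^{4n+3}=\{(u_0,\ldots,u_n)\in\mathbb{H}^{n+1}:|u_0|^2+\cdots+|u_n|^2=1\}$, where $\mathbb{H}$ denotes the quaternions and $n\ge1$, and let $v\in T_pS^{4n+3}$. Let $\gamma_R(t)=(u_0(t),\ldots,u_n(t))$ be the great circle with $\gamma_R(0)=p$ and $\dot\gamma_R(0)=v$. Then the sub-Riemannian geodesic corresponding to $\gamma_R$, i.e. the horizontal lift starting at $p$ of the projection of $\gamma_R$ to $\mathbb{H}P^n$ under the quaternionic Hopf map, which is a normal sub-Riemannian geodesic, is given by $$\gamma(t)=\left(u_0(t)\cdot e^{-tA(v)},\ldots,u_n(t)\cdot e^{-tA(v)}\right).$$
   Context: Identify $\mathbb{H}^{n+1}\cong\mathbb{R}^{4(n+1)}$ with standard inner product $\langle\cdot,\cdot\rangle$. For $p\in S^{4n+3}$ set $V^1_{n+1}(p)=p\cdot i$, $V^2_{n+1}(p)=p\cdot j$, $V^3_{n+1}(p)=p\cdot k$ (componentwise right multiplication by the quaternion units). The group $Sp(1)\cong S^3$ of unit quaternions acts on $S^{4n+3}$ by componentwise right multiplication, with quotient map the quaternionic Hopf map $S^{4n+3}\to\mathbb{H}P^n$, $(q_0,\ldots,q_n)\mapsto[q_0:\cdots:q_n]$. The horizontal distribution $\mathcal H$ is the orthogonal complement of $\mathrm{span}\{V^1_{n+1},V^2_{n+1},V^3_{n+1}\}$ in $TS^{4n+3}$, with sub-Riemannian metric the restriction of $\langle\cdot,\cdot\rangle$. For $v\in T_pS^{4n+3}$ put $A(v)=i\langle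 v,V^1_{n+1}(p)\rangle+j\langle v,V^2_{n+1}(p)\rangle+k\langle v,V^3_{n+1}(p)\rangle$. The quaternionic exponential is $e^{ai+bj+ck}=\cos r+\frac{\sin r}{r}(ai+bj+ck)$ with $r=\sqrt{a^2+b^2+c^2}$ (and $e^0=1$). A curve is horizontal if its velocity lies in $\mathcal H$; a horizontal lift of a curve in $\mathbb{H}P^n$ is a horizontal curve in $S^{4n+3}$ projecting to it. A normal sub-Riemannian geodesic is the projection to the manifold of a solution of the Hamiltonian system on the cotangent bundle with Hamiltonian $H(q,\lambda)=\frac12\sum_m\lambda(X_m(q))^2$, where $X_1,X_2,\ldots$ is any local orthonormal frame of $\mathcal H$. The great circle is $\gamma_R(t)=p\cos(\|v\|t)+\frac{v}{\|v\|}\sin(\|v\|t)$ (constant if $v=0$). *)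

theory Defs
  imports "HOL-Analysis.Analysis"
begin

section \<open>Quaternions\<close>

datatype quat = Quat (Re: real) (Im1: real) (Im2: real) (Im3: real)

hide_const (open) Complex.Re

lemma quat_eq_iff: "x = y \<longleftrightarrow> Re x = Re y \<and> Im1 x = Im1 y \<and> Im2 x = Im2 y \<and> Im3 x = Im3 y"
  by (cases x; cases y) auto

instantiation quat :: real_algebra_1
begin

definition "0 = Quat 0 0 0 0"
definition "1 = Quat 1 0 0 0"
definition "x + y = Quat (Re x + Re y) (Im1 x + Im1 y) (Im2 x + Im2 y) (Im3 x + Im3 y)"
definition "- x = Quat (- Re x) (- Im1 x) (- Im2 x) (- Im3 x)"
definition "x - y = Quat (Re x - Re y) (Im1 x - Im1 y) (Im2 x - Im2 y) (Im3 x - Im3 y)"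
definition "r *\<^sub>R x = Quat (r * Re x) (r * Im1 x) (r * Im2 x) (r * Im3 x)"
definition "x * y = Quat
  (Re x * Re y - Im1 x * Im1 y - Im2 x * Im2 y - Im3 x * Im3 y)
  (Re x * Im1 y + Im1 x * Re y + Im2 x * Im3 y - Im3 x * Im2 y)
  (Re x * Im2 y - Im1 x * Im3 y + Im2 x * Re y + Im3 x * Im1 y)
  (Re x * Im3 y + Im1 x * Im2 y - Im2 x * Im1 y + Im3 x * Re y)"

instance
  by standard
    (simp_all add: quat_eq_iff zero_quat_def one_quat_def plus_quat_def uminus_quat_def
      minus_quat_def scaleR_quat_def times_quat_def algebra_simps)

end

lemma quat_sel_simps [simp]:
  "Re 0 = 0" "Im1 0 = 0" "Im2 0 = 0" "Im3 0 = 0"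
  "Re 1 = 1" "Im1 1 = 0" "Im2 1 = 0" "Im3 1 = 0"
  "Re (x + y) = Re x + Re y" "Im1 (x + y) = Im1 x + Im1 y"
  "Im2 (x + y) = Im2 x + Im2 y" "Im3 (x + y) = Im3 x + Im3 y"
  "Re (- x) = - Re x" "Im1 (- x) = - Im1 x" "Im2 (- x) = - Im2 x" "Im3 (- x) = - Im3 x"
  "Re (x - y) = Re x - Re y" "Im1 (x - y) = Im1 x - Im1 y"
  "Im2 (x - y) = Im2 x - Im2 y" "Im3 (x - y) = Im3 x - Im3 y"
  "Re (r *\<^sub>R x) = r * Re x" "Im1 (r *\<^sub>R x) = r * Im1 x"
  "Im2 (r *\<^sub>R x) = r * Im2 x" "Im3 (r *\<^sub>R x) = r * Im3 x"
  "Re (x * y) = Re x * Re y - Im1 x * Im1 y - Im2 x * Im2 y - Im3 x * Im3 y"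
  "Im1 (x * y) = Re x * Im1 y + Im1 x * Re y + Im2 x * Im3 y - Im3 x * Im2 y"
  "Im2 (x * y) = Re x * Im2 y - Im1 x * Im3 y + Im2 x * Re y + Im3 x * Im1 y"
  "Im3 (x * y) = Re x * Im3 y + Im1 x * Im2 y - Im2 x * Im1 y + Im3 x * Re y"
  by (simp_all add: zero_quat_def one_quat_def plus_quat_def uminus_quat_def
      minus_quat_def scaleR_quat_def times_quat_def)

instantiation quat :: real_inner
begin

definition "inner x y = Re x * Re y + Im1 x * Im1 y + Im2 x * Im2 y + Im3 x * Im3 y"
definition "norm (x :: quat) = sqrt (inner x x)"
definition "sgn (x :: quat) = x /\<^sub>R norm x"
definition "dist (x :: quat) y = norm (x - y)"
definition [code del]:
  "(uniformity :: (quat \<times> quat) filter) = (INF e\<in>{0 <..}. principal {(x, y). dist x y < e})"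
definition [code del]:
  "open (U :: quat set) \<longleftrightarrow> (\<forall>x\<in>U. eventually (\<lambda>(x', y). x' = x \<longrightarrow> y \<in> U) uniformity)"

instance
proof
  fix x y z :: quat and r :: real
  show "inner x y = inner y x" "inner (x + y) z = inner x z + inner y z"
    "inner (r *\<^sub>R x) y = r * inner x y"
    by (simp_all add: inner_quat_def algebra_simps)
  show "0 \<le> inner x x"
    by (simp add: inner_quat_def)
  have sq: "inner x x = ((Re x)\<^sup>2 + (Im1 x)\<^sup>2) + ((Im2 x)\<^sup>2 + (Im3 x)\<^sup>2)"
    by (simp add: inner_quat_def power2_eq_square)
  show "inner x x = 0 \<longleftrightarrow> x = 0"
    unfolding sq by (subst add_nonneg_eq_0_iff) (auto simp: quat_eq_iff)
qed (simp_all add: norm_quat_def sgn_quat_def dist_quat_def uniformity_quat_def open_quat_def)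

end

instantiation quat :: real_normed_div_algebra
begin

definition "inverse x = Quat (Re x / inner x x) (- Im1 x / inner x x)
  (- Im2 x / inner x x) (- Im3 x / inner x x)"
definition "x div (y :: quat) = x * inverse y"

instance
proof
  fix x y :: quat
  show "inverse x * x = 1" if "x \<noteq> 0"
  proof -
    from that have nz: "inner x x \<noteq> 0" by simp
    have "inverse x = (1 / inner x x) *\<^sub>R Quat (Re x) (- Im1 x) (- Im2 x) (- Im3 x)"
      by (simp add: inverse_quat_def quat_eq_iff)
    moreover have "Quat (Re x) (- Im1 x) (- Im2 x) (- Im3 x) * x = inner x x *\<^sub>R 1"
      by (simp add: quat_eq_iff inner_quat_def)
    ultimately show ?thesis using nz by simp
  qed
  show "x * inverse x = 1" if "x \<noteq> 0"
  proof -
    from that have nz: "inner x x \<noteq> 0" by simp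
    have "inverse x = (1 / inner x x) *\<^sub>R Quat (Re x) (- Im1 x) (- Im2 x) (- Im3 x)"
      by (simp add: inverse_quat_def quat_eq_iff)
    moreover have "x * Quat (Re x) (- Im1 x) (- Im2 x) (- Im3 x) = inner x x *\<^sub>R 1"
      by (simp add: quat_eq_iff inner_quat_def)
    ultimately show ?thesis using nz by simp
  qed
  show "x div y = x * inverse y" by (fact divide_quat_def)
  show "inverse (0 :: quat) = 0" by (simp add: inverse_quat_def quat_eq_iff)
  have "inner (x * y) (x * y) = inner x x * inner y y"
    by (simp add: inner_quat_def) algebra
  then show "norm (x * y) = norm x * norm y"
    by (simp add: norm_quat_def real_sqrt_mult)
qed

end

definition quat_i :: quat where "quat_i = Quat 0 1 0 0"
definition quat_j :: quat where "quat_j = Quat 0 0 1 0"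
definition quat_k :: quat where "quat_k = Quat 0 0 0 1"

lemma quat_units_sel [simp]:
  "Re quat_i = 0" "Im1 quat_i = 1" "Im2 quat_i = 0" "Im3 quat_i = 0"
  "Re quat_j = 0" "Im1 quat_j = 0" "Im2 quat_j = 1" "Im3 quat_j = 0"
  "Re quat_k = 0" "Im1 quat_k = 0" "Im2 quat_k = 0" "Im3 quat_k = 1"
  by (simp_all add: quat_i_def quat_j_def quat_k_def)

lemma quat_units_mult:
  "quat_i * quat_i = - 1" "quat_j * quat_j = - 1" "quat_k * quat_k = - 1"
  "quat_i * quat_j = quat_k" "quat_j * quat_k = quat_i" "quat_k * quat_i = quat_j"
  by (simp_all add: quat_eq_iff)

instantiation quat :: euclidean_space
begin

definition "Basis = {1, quat_i, quat_j, quat_k}"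

instance
proof
  show "(Basis :: quat set) \<noteq> {}" "finite (Basis :: quat set)"
    by (simp_all add: Basis_quat_def)
  fix u v x :: quat
  show "inner u v = (if u = v then 1 else 0)" if "u \<in> Basis" "v \<in> Basis"
    using that by (auto simp: Basis_quat_def inner_quat_def quat_eq_iff)
  show "(\<forall>u\<in>Basis. inner x u = 0) \<longleftrightarrow> x = 0"
    unfolding Basis_quat_def by (simp add: inner_quat_def) (auto simp: quat_eq_iff)
qed

end

text \<open>The exponential of a purely imaginary quaternion; the real part of the argument is ignored.\<close>

definition quat_exp :: "quat \<Rightarrow> quat" where
  "quat_exp q = (let a = Im1 q; b = Im2 q; c = Im3 q; r = sqrt (a\<^sup>2 + b\<^sup>2 + c\<^sup>2) in
     if r = 0 then 1
     else of_real (cos r) + (sin r / r) *\<^sub>R (a *\<^sub>R quat_i + b *\<^sub>R quat_j + c *\<^sub>R quat_k))"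


section \<open>The sphere in quaternionic space and the quaternionic Hopf map\<close>

text \<open>
  Quaternionic \<open>(n+1)\<close>-space is \<^typ>\<open>quat ^ 'm\<close> with \<open>CARD('m) = n + 1\<close>. Its library inner product
  is the standard one of real \<open>4(n+1)\<close>-space, and its unit sphere is \<^term>\<open>sphere 0 1\<close>.
\<close>

definition rmult :: "quat ^ 'm \<Rightarrow> quat \<Rightarrow> quat ^ 'm"  (infixl \<open>\<odot>\<close> 75) where
  "p \<odot> u = (\<chi> l. p $ l * u)"

definition V1 :: "quat ^ 'm \<Rightarrow> quat ^ 'm" where "V1 p = p \<odot> quat_i"
definition V2 :: "quat ^ 'm \<Rightarrow> quat ^ 'm" where "V2 p = p \<odot> quat_j"
definition V3 :: "quat ^ 'm \<Rightarrow> quat ^ 'm" where "V3 p = p \<odot> quat_k"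

definition tangent_space :: "quat ^ 'm \<Rightarrow> (quat ^ 'm) set" where
  "tangent_space p = {v. p \<bullet> v = 0}"

definition horizontal_space :: "quat ^ 'm \<Rightarrow> (quat ^ 'm) set" where
  "horizontal_space p = {v \<in> tangent_space p. \<forall>w \<in> span {V1 p, V2 p, V3 p}. v \<bullet> w = 0}"

definition A_quat :: "quat ^ 'm \<Rightarrow> quat ^ 'm \<Rightarrow> quat" where
  "A_quat p v = (v \<bullet> V1 p) *\<^sub>R quat_i + (v \<bullet> V2 p) *\<^sub>R quat_j + (v \<bullet> V3 p) *\<^sub>R quat_k"

definition great_circle :: "quat ^ 'm \<Rightarrow> quat ^ 'm \<Rightarrow> real \<Rightarrow> quat ^ 'm" where
  "great_circle p v t =
     (if v = 0 then p else cos (norm v * t) *\<^sub>R p + sin (norm v * t) *\<^sub>R (v /\<^sub>R norm v))"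

text \<open>
  The point \<open>[q\<^sub>0 : \<dots> : q\<^sub>n]\<close> of quaternionic projective space is represented as the
  set of its homogeneous coordinate vectors, scalars acting from the right.
\<close>

definition hopf :: "quat ^ 'm \<Rightarrow> (quat ^ 'm) set" where
  "hopf q = {q \<odot> u | u. u \<noteq> 0}"

definition horizontal_curve :: "(real \<Rightarrow> quat ^ 'm) \<Rightarrow> bool" where
  "horizontal_curve c \<longleftrightarrow> (\<forall>t. c t \<in> sphere 0 1) \<and>
     (\<forall>t. \<exists>c'. (c has_vector_derivative c') (at t) \<and> c' \<in> horizontal_space (c t))"

definition horizontal_lift :: "(real \<Rightarrow> (quat ^ 'm) set) \<Rightarrow> (real \<Rightarrow> quat ^ 'm) \<Rightarrow> bool" where
  "horizontal_lift b c \<longleftrightarrow> horizontal_curve c \<and> (\<forall>t. hopf (c t) = b t)"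


section \<open>Normal sub-Riemannian geodesics\<close>

text \<open>
  A covector at a point \<open>q\<close> of the sphere, i.e. a linear functional on the tangent space at \<open>q\<close>,
  is represented by its unique extension to the ambient space that vanishes on the normal vector
  \<open>q\<close>. This embeds the part of the cotangent bundle of the sphere lying over \<open>U\<close> as follows.
\<close>

definition cotangent_over ::
  "(quat ^ 'm) set \<Rightarrow> ((quat ^ 'm) \<times> ((quat ^ 'm) \<Rightarrow>\<^sub>L real)) set" where
  "cotangent_over U = {(q, l). q \<in> U \<and> q \<in> sphere 0 1 \<and> blinfun_apply l q = 0}"

text \<open>
  The tangent space of the cotangent bundle at \<open>(q, l)\<close>, obtained by linearizing the equations
  \<open>q \<bullet> q = 1\<close> and \<open>l q = 0\<close>.
\<close>

definition tangent_cotangent ::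
  "(quat ^ 'm) \<times> ((quat ^ 'm) \<Rightarrow>\<^sub>L real) \<Rightarrow> ((quat ^ 'm) \<times> ((quat ^ 'm) \<Rightarrow>\<^sub>L real)) set" where
  "tangent_cotangent = (\<lambda>(q, l). {(w, m). q \<bullet> w = 0 \<and> blinfun_apply m q + blinfun_apply l w = 0})"

text \<open>
  The tautological one-form sends \<open>(w, m)\<close> at \<open>(q, l)\<close> to \<open>l w\<close>; the following is minus its
  exterior derivative, \<open>dq \<and> dp\<close> in canonical coordinates. It is the restriction of a constant
  form on the ambient space, hence does not mention the base point.
\<close>

definition canonical_form ::
  "(quat ^ 'm) \<times> ((quat ^ 'm) \<Rightarrow>\<^sub>L real) \<Rightarrow> (quat ^ 'm) \<times> ((quat ^ 'm) \<Rightarrow>\<^sub>L real) \<Rightarrow> real" where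
  "canonical_form = (\<lambda>(w, m) (w', m'). blinfun_apply m' w - blinfun_apply m w')"

text \<open>
  No regularity in the base point is asked of a frame: the Hamiltonian at \<open>q\<close> depends only on the
  frame vectors at \<open>q\<close>. Frames are quantified universally below, so this includes all
  smooth ones.
\<close>

definition local_frame ::
  "(quat ^ 'm) set \<Rightarrow> nat \<Rightarrow> (nat \<Rightarrow> quat ^ 'm \<Rightarrow> quat ^ 'm) \<Rightarrow> bool" where
  "local_frame U N X \<longleftrightarrow> openin (top_of_set (sphere 0 1)) U \<and>
     (\<forall>q\<in>U. (\<forall>i<N. \<forall>j<N. X i q \<bullet> X j q = (if i = j then 1 else 0)) \<and>
        span ((\<lambda>i. X i q) ` {..<N}) = horizontal_space q)"

definition hamiltonian ::
  "nat \<Rightarrow> (nat \<Rightarrow> quat ^ 'm \<Rightarrow> quat ^ 'm) \<Rightarrow> (quat ^ 'm) \<times> ((quat ^ 'm) \<Rightarrow>\<^sub>L real) \<Rightarrow> real" where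
  "hamiltonian N X = (\<lambda>(q, l). 1 / 2 * (\<Sum>i<N. (blinfun_apply l (X i q))\<^sup>2))"

text \<open>
  \<open>Z\<close> is the Hamiltonian vector of \<open>H\<close> at \<open>z\<close>. The derivative \<open>D\<close> is taken along the cotangent
  bundle, which determines it on vectors tangent to the bundle; only these are used.
\<close>

definition hamiltonian_vector ::
  "(quat ^ 'm) set \<Rightarrow> ((quat ^ 'm) \<times> ((quat ^ 'm) \<Rightarrow>\<^sub>L real) \<Rightarrow> real) \<Rightarrow>
     (quat ^ 'm) \<times> ((quat ^ 'm) \<Rightarrow>\<^sub>L real) \<Rightarrow> (quat ^ 'm) \<times> ((quat ^ 'm) \<Rightarrow>\<^sub>L real) \<Rightarrow> bool" where
  "hamiltonian_vector U H z Z \<longleftrightarrow> Z \<in> tangent_cotangent z \<and>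
     (\<exists>D. (H has_derivative D) (at z within cotangent_over U) \<and>
        (\<forall>W \<in> tangent_cotangent z. D W = canonical_form Z W))"

definition hamiltonian_solution ::
  "(real \<Rightarrow> (quat ^ 'm) \<times> ((quat ^ 'm) \<Rightarrow>\<^sub>L real)) \<Rightarrow> bool" where
  "hamiltonian_solution z \<longleftrightarrow> (\<forall>t. z t \<in> cotangent_over (sphere 0 1)) \<and>
     (\<forall>t. \<exists>Z. (z has_vector_derivative Z) (at t) \<and>
        (\<forall>U N X. local_frame U N X \<and> fst (z t) \<in> U \<longrightarrow>
           hamiltonian_vector U (hamiltonian N X) (z t) Z))"

definition normal_geodesic :: "(real \<Rightarrow> quat ^ 'm) \<Rightarrow> bool" where
  "normal_geodesic c \<longleftrightarrow> (\<exists>z. hamiltonian_solution z \<and> (\<forall>t. c t = fst (z t)))"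


section \<open>Consistency of the definitions\<close>

lemma great_circle_0 [simp]: "great_circle p v 0 = p"
  by (simp add: great_circle_def)

lemma great_circle_velocity: "(great_circle p v has_vector_derivative v) (at 0)"
proof (cases "v = 0")
  case True
  then have "great_circle p v = (\<lambda>_. p)" by (simp add: great_circle_def fun_eq_iff)
  then show ?thesis using True by simp
next
  case False
  have "((\<lambda>t. cos (norm v * t) *\<^sub>R p + sin (norm v * t) *\<^sub>R (v /\<^sub>R norm v))
      has_vector_derivative v) (at 0)"
    using False by (auto intro!: derivative_eq_intros)
  moreover have "great_circle p v =
      (\<lambda>t. cos (norm v * t) *\<^sub>R p + sin (norm v * t) *\<^sub>R (v /\<^sub>R norm v))"
    using False by (simp add: great_circle_def fun_eq_iff)
  ultimately show ?thesis by simp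
qed

lemma great_circle_sphere:
  assumes "p \<in> sphere 0 1" "v \<in> tangent_space p"
  shows "great_circle p v t \<in> sphere 0 1"
proof (cases "v = 0")
  case True
  then show ?thesis using assms by (simp add: great_circle_def)
next
  case False
  have pp: "p \<bullet> p = 1" using assms by (simp add: norm_eq_1)
  have pv: "p \<bullet> v = 0" "v \<bullet> p = 0"
    using assms by (simp_all add: tangent_space_def inner_commute)
  define w where "w = v /\<^sub>R norm v"
  have "norm w = 1" "p \<bullet> w = 0" "w \<bullet> p = 0"
    using False pv by (simp_all add: w_def)
  moreover from this have "w \<bullet> w = 1" by (simp add: norm_eq_1)
  ultimately have "great_circle p v t \<bullet> great_circle p v t =
      (cos (norm v * t))\<^sup>2 + (sin (norm v * t))\<^sup>2"
    using False pp unfolding great_circle_def w_def[symmetric]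
    by (simp add: inner_add_left inner_add_right power2_eq_square)
  then show ?thesis by (simp add: norm_eq_1)
qed

lemma norm_rmult: "norm (p \<odot> u) = norm p * norm u"
proof -
  have "(norm (p \<odot> u))\<^sup>2 = (\<Sum>l\<in>UNIV. (norm (p $ l))\<^sup>2 * (norm u)\<^sup>2)"
    by (simp add: power2_norm_eq_inner inner_vec_def rmult_def flip: power_mult_distrib)
      (simp add: norm_mult flip: power2_norm_eq_inner power_mult_distrib)
  also have "\<dots> = (norm p * norm u)\<^sup>2"
    by (simp add: power_mult_distrib power2_norm_eq_inner[of p] inner_vec_def sum_distrib_right
        flip: power2_norm_eq_inner)
  finally show ?thesis by simp
qed

lemma rmult_rmult: "p \<odot> u \<odot> u' = p \<odot> (u * u')"
  by (simp add: rmult_def vec_eq_iff mult.assoc)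

text \<open>The fibres of the Hopf map on the sphere are the orbits of the unit quaternions.\<close>

lemma hopf_eq_iff:
  assumes "p \<in> sphere 0 1" "q \<in> sphere 0 1"
  shows "hopf p = hopf q \<longleftrightarrow> (\<exists>u. norm u = 1 \<and> q = p \<odot> u)"
proof
  assume eq: "hopf p = hopf q"
  have "q \<in> hopf q"
    by (auto simp: hopf_def rmult_def vec_eq_iff intro!: exI[of _ 1])
  then obtain u where "q = p \<odot> u" using eq by (auto simp: hopf_def)
  moreover from this have "norm u = 1"
    using assms norm_rmult[of p u] by simp
  ultimately show "\<exists>u. norm u = 1 \<and> q = p \<odot> u" by blast
next
  assume "\<exists>u. norm u = 1 \<and> q = p \<odot> u"
  then obtain u where u: "norm u = 1" "q = p \<odot> u" by blast
  then have nz: "u \<noteq> 0" by auto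
  have "\<exists>u''. p \<odot> u' = p \<odot> (u * u'') \<and> u'' \<noteq> 0" if "u' \<noteq> 0" for u'
    using nz that
    by (intro exI[of _ "inverse u * u'"]) (simp flip: mult.assoc)
  moreover have "u * u' \<noteq> 0" if "u' \<noteq> 0" for u'
    using nz that by simp
  ultimately show "hopf p = hopf q"
    unfolding hopf_def u(2) rmult_rmult by blast
qed

lemma frame_vectors_orthonormal:
  assumes "p \<in> sphere 0 1"
  shows "p \<bullet> p = 1" "V1 p \<bullet> V1 p = 1" "V2 p \<bullet> V2 p = 1" "V3 p \<bullet> V3 p = 1"
    "p \<bullet> V1 p = 0" "p \<bullet> V2 p = 0" "p \<bullet> V3 p = 0"
    "V1 p \<bullet> V2 p = 0" "V1 p \<bullet> V3 p = 0" "V2 p \<bullet> V3 p = 0"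
proof -
  show "p \<bullet> p = 1" using assms by (simp add: norm_eq_1)
  have "norm quat_i = 1" "norm quat_j = 1" "norm quat_k = 1"
    by (simp_all add: norm_quat_def inner_quat_def)
  then have "norm (V1 p) = 1" "norm (V2 p) = 1" "norm (V3 p) = 1"
    using assms by (simp_all add: V1_def V2_def V3_def norm_rmult)
  then show "V1 p \<bullet> V1 p = 1" "V2 p \<bullet> V2 p = 1" "V3 p \<bullet> V3 p = 1"
    by (simp_all add: norm_eq_1)
  show "p \<bullet> V1 p = 0" "p \<bullet> V2 p = 0" "p \<bullet> V3 p = 0"
    "V1 p \<bullet> V2 p = 0" "V1 p \<bullet> V3 p = 0" "V2 p \<bullet> V3 p = 0"
    by (simp_all add: V1_def V2_def V3_def inner_vec_def rmult_def inner_quat_def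
        algebra_simps sum.neutral)
qed

text \<open>Frames exist around every point, so quantifying over all of them is not vacuous.\<close>

lemma local_frame_exists:
  "\<exists>X. local_frame (sphere 0 1) (4 * (CARD('m) - 1)) (X :: nat \<Rightarrow> quat ^ 'm \<Rightarrow> quat ^ 'm)"
proof -
  have "\<exists>f. (\<forall>i<4 * (CARD('m) - 1). \<forall>j<4 * (CARD('m) - 1).
        f i \<bullet> f j = (if i = j then 1 else 0)) \<and>
      span (f ` {..<4 * (CARD('m) - 1)}) = horizontal_space q"
    if q: "q \<in> sphere 0 1" for q :: "quat ^ 'm"
  proof -
    let ?B = "{q, V1 q, V2 q, V3 q}"
    note on = frame_vectors_orthonormal[OF q]
    have sub: "subspace (horizontal_space q)"
      by (auto simp: horizontal_space_def tangent_space_def subspace_def inner_add_left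
          inner_add_right)
    have ortho: "pairwise orthogonal ?B"
      using on by (auto simp: pairwise_def orthogonal_def inner_commute)
    have "0 \<notin> ?B" using on by auto
    then have ind: "independent ?B"
      using ortho pairwise_orthogonal_independent by blast
    have neq: "q \<noteq> V1 q" "q \<noteq> V2 q" "q \<noteq> V3 q" "V1 q \<noteq> V2 q" "V1 q \<noteq> V3 q" "V2 q \<noteq> V3 q"
      using on by force+
    have dimB: "dim (span ?B) = 4"
      using ind neq by (simp add: dim_eq_card_independent)
    have hs: "horizontal_space q = {y \<in> UNIV. \<forall>x \<in> span ?B. orthogonal x y}"
    proof (intro set_eqI iffI)
      fix y assume y: "y \<in> horizontal_space q"
      then have "\<forall>x\<in>?B. orthogonal y x"
        by (auto simp: horizontal_space_def tangent_space_def orthogonal_def inner_commute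
            span_base)
      then show "y \<in> {y \<in> UNIV. \<forall>x \<in> span ?B. orthogonal x y}"
        using orthogonal_to_span[where S = ?B and x = y] orthogonal_commute by blast
    next
      fix y assume y: "y \<in> {y \<in> UNIV. \<forall>x \<in> span ?B. orthogonal x y}"
      have "span {V1 q, V2 q, V3 q} \<subseteq> span ?B" by (rule span_mono) auto
      then show "y \<in> horizontal_space q"
        using y by (auto simp: horizontal_space_def tangent_space_def orthogonal_def
            inner_commute span_base)
    qed
    have "DIM(quat) = 4"
      by (simp add: Basis_quat_def quat_eq_iff)
    then have "dim (horizontal_space q) = 4 * (CARD('m) - 1)"
      using dim_subspace_orthogonal_to_vectors[of "span ?B" UNIV] dimB
      by (simp add: hs algebra_simps)
    then obtain B where B: "pairwise orthogonal B" "\<And>x. x \<in> B \<Longrightarrow> norm x = 1"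
      "independent B" "card B = 4 * (CARD('m) - 1)" "span B = horizontal_space q"
      using orthonormal_basis_subspace[OF sub] by metis
    have "finite B" using B(3) by (rule independent_imp_finite)
    then obtain f where f: "bij_betw f {..<4 * (CARD('m) - 1)} B"
      using ex_bij_betw_nat_finite[of B] B(4) by (auto simp: lessThan_atLeast0)
    have "f i \<bullet> f j = (if i = j then 1 else 0)"
      if "i < 4 * (CARD('m) - 1)" "j < 4 * (CARD('m) - 1)" for i j
    proof (cases "i = j")
      case True
      then show ?thesis using B(2) f that by (auto simp: bij_betw_def norm_eq_1)
    next
      case False
      then have "f i \<noteq> f j" "f i \<in> B" "f j \<in> B"
        using f that by (auto simp: bij_betw_def inj_on_def)
      then show ?thesis using False B(1) by (auto simp: pairwise_def orthogonal_def)
    qed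
    moreover have "f ` {..<4 * (CARD('m) - 1)} = B" using f by (simp add: bij_betw_def)
    ultimately show ?thesis using B(5) by (intro exI[of _ f]) auto
  qed
  then obtain F where F: "\<And>q :: quat ^ 'm. q \<in> sphere 0 1 \<Longrightarrow>
      (\<forall>i<4 * (CARD('m) - 1). \<forall>j<4 * (CARD('m) - 1).
        F q i \<bullet> F q j = (if i = j then 1 else 0)) \<and>
      span (F q ` {..<4 * (CARD('m) - 1)}) = horizontal_space q"
    by metis
  show ?thesis
    unfolding local_frame_def using F
    by (intro exI[of _ "\<lambda>i q. F q i"]) (simp add: image_def)
qed

end

theory Submission
  imports Defs
begin

text \<open>
  Let \<open>h\<close> be the quaternionic Hermitian product. On tangent vectors its value against the base point
  is the vertical component, so \<open>x\<close> is horizontal at \<open>q\<close> iff \<open>h q x = 0\<close>, and \<open>A v = h p v\<close>. Along a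
  great circle \<open>c\<close> the vertical component \<open>h c c'\<close> is the constant \<open>A v\<close>, and twisting \<open>c\<close> by
  \<open>exp (- t A)\<close> cancels it. Two horizontal lifts of one curve differ by the unit quaternion
  \<open>h \<gamma> \<delta>\<close>, whose derivative vanishes. For normality, the Hamiltonian on the cotangent bundle of
  the sphere is half the squared norm of the covector minus its squared vertical part, whatever the
  frame, and the twisted velocity of the great circle is a covector solving Hamilton's equations.
\<close>

section \<open>The quaternionic Hermitian product\<close>

definition quat_cnj :: "quat \<Rightarrow> quat" where
  "quat_cnj x = Quat (Re x) (- Im1 x) (- Im2 x) (- Im3 x)"

lemma quat_cnj_sel [simp]:
  "Re (quat_cnj x) = Re x" "Im1 (quat_cnj x) = - Im1 x"
  "Im2 (quat_cnj x) = - Im2 x" "Im3 (quat_cnj x) = - Im3 x"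
  by (simp_all add: quat_cnj_def)

lemma quat_sel_sum:
  "Re (sum f S) = (\<Sum>x\<in>S. Re (f x))" "Im1 (sum f S) = (\<Sum>x\<in>S. Im1 (f x))"
  "Im2 (sum f S) = (\<Sum>x\<in>S. Im2 (f x))" "Im3 (sum f S) = (\<Sum>x\<in>S. Im3 (f x))"
  by (induction S rule: infinite_finite_induct) simp_all

lemma quat_sel_of_real [simp]:
  "Re (of_real r) = r" "Im1 (of_real r) = 0" "Im2 (of_real r) = 0" "Im3 (of_real r) = 0"
  by (simp_all add: of_real_def)

text \<open>The first factor is conjugated because scalars act from the right: in
  \<open>hprod (p \<odot> u) (q \<odot> w)\<close> both \<open>u\<close> and \<open>w\<close> can
  then be pulled out, one on each side.\<close>

definition hprod :: "quat ^ 'm \<Rightarrow> quat ^ 'm \<Rightarrow> quat" where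
  "hprod p q = (\<Sum>l\<in>UNIV. quat_cnj (p $ l) * q $ l)"

text \<open>For quaternions, \<open>Re (quat_cnj a * b)\<close> is the inner product of
  \<open>a\<close> and \<open>b\<close>, and the imaginary parts are those of \<open>b\<close> with
  \<open>a * quat_i\<close>, \<open>a * quat_j\<close>, \<open>a * quat_k\<close>.\<close>

lemma hprod_sel:
  "Re (hprod p x) = p \<bullet> x" "Im1 (hprod p x) = x \<bullet> V1 p"
  "Im2 (hprod p x) = x \<bullet> V2 p" "Im3 (hprod p x) = x \<bullet> V3 p"
  by (simp_all add: hprod_def quat_sel_sum inner_vec_def inner_quat_def V1_def V2_def V3_def
      rmult_def algebra_simps)

lemma hprod_rmult: "hprod (p \<odot> u) (q \<odot> w) = quat_cnj u * hprod p q * w"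
proof -
  have "quat_cnj (a * b) = quat_cnj b * quat_cnj a" for a b
    by (simp add: quat_eq_iff algebra_simps)
  then show ?thesis
    by (simp add: hprod_def rmult_def sum_distrib_left sum_distrib_right mult.assoc)
qed

lemma rmult_1 [simp]: "p \<odot> 1 = p"
  by (simp add: rmult_def vec_eq_iff)

lemma hprod_rmult_left: "hprod (p \<odot> u) q = quat_cnj u * hprod p q"
  using hprod_rmult[of p u q 1] by simp

lemma hprod_rmult_right: "hprod p (q \<odot> w) = hprod p q * w"
  using hprod_rmult[of p 1 q w] by (simp add: quat_cnj_def quat_eq_iff)

lemma hprod_commute: "hprod q p = quat_cnj (hprod p q)"
  by (simp add: quat_eq_iff hprod_def quat_sel_sum algebra_simps flip: sum_negf)

lemma hprod_self: "hprod p p = of_real ((norm p)\<^sup>2)"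
proof -
  have "quat_cnj (hprod p p) = hprod p p"
    using hprod_commute[of p p] by simp
  then show ?thesis
    by (simp add: quat_eq_iff hprod_sel(1) power2_norm_eq_inner)
qed

lemma bounded_bilinear_hprod: "bounded_bilinear hprod"
proof -
  have "quat_cnj (a + b) = quat_cnj a + quat_cnj b" "quat_cnj (r *\<^sub>R a) = r *\<^sub>R quat_cnj a" for a b r
    by (simp_all add: quat_eq_iff)
  then show ?thesis
    unfolding bilinear_conv_bounded_bilinear[symmetric] bilinear_def linear_iff hprod_def
    by (simp add: distrib_left distrib_right sum.distrib scaleR_sum_right)
qed

lemma bounded_bilinear_rmult: "bounded_bilinear rmult"
  unfolding bilinear_conv_bounded_bilinear[symmetric] bilinear_def linear_iff
  by (auto simp: rmult_def vec_eq_iff algebra_simps)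

interpretation hprod: bounded_bilinear hprod
  by (fact bounded_bilinear_hprod)

interpretation rmult: bounded_bilinear rmult
  by (fact bounded_bilinear_rmult)

text \<open>Vanishing of the real part is tangency; the imaginary parts test orthogonality on the
  generators of the vertical space.\<close>

lemma horizontal_space_iff: "x \<in> horizontal_space q \<longleftrightarrow> hprod q x = 0"
proof -
  have "(\<forall>w \<in> span S. x \<bullet> w = 0) \<longleftrightarrow> (\<forall>w \<in> S. x \<bullet> w = 0)" for S
    using orthogonal_to_span[of _ S x] span_base[of _ S] by (auto simp: orthogonal_def)
  then show ?thesis
    by (simp add: horizontal_space_def tangent_space_def quat_eq_iff hprod_sel)
qed

lemma A_quat_eq_hprod:
  assumes "v \<in> tangent_space p"
  shows "A_quat p v = hprod p v"
  using assms by (simp add: A_quat_def quat_eq_iff hprod_sel tangent_space_def)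

text \<open>For \<open>x = q\<close> on the sphere this is the vertical projection of \<xi>. A free
  \<open>x\<close> also covers variations of the base point.\<close>

lemma rmult_A_quat:
  "x \<odot> A_quat q \<xi> = (\<xi> \<bullet> V1 q) *\<^sub>R V1 x + (\<xi> \<bullet> V2 q) *\<^sub>R V2 x + (\<xi> \<bullet> V3 q) *\<^sub>R V3 x"
  by (simp add: A_quat_def V1_def V2_def V3_def rmult.add_right rmult.scaleR_right)

text \<open>The adjoint of right multiplication by \<open>a\<close> is right multiplication by its
  conjugate, here \<open>- a\<close>.\<close>

lemma inner_rmult_imaginary:
  assumes "Re a = 0"
  shows "(x \<odot> a) \<bullet> y = - (x \<bullet> (y \<odot> a))"
  using assms
  by (simp add: inner_vec_def rmult_def inner_quat_def algebra_simps flip: sum_negf)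

section \<open>One-parameter groups of unit quaternions\<close>

lemma imaginary_square:
  assumes "Re a = 0"
  shows "a * a = - of_real ((norm a)\<^sup>2)"
  using assms by (simp add: quat_eq_iff power2_norm_eq_inner inner_quat_def)

text \<open>For \<open>a = 0\<close> the quotient is \<open>0 / 0 = 0\<close>, and the formula still holds.\<close>

lemma quat_exp_scaleR:
  assumes "Re a = 0"
  shows "quat_exp (t *\<^sub>R a) = of_real (cos (t * norm a)) + (sin (t * norm a) / norm a) *\<^sub>R a"
proof -
  define r where "r = norm a"
  have r: "r = sqrt ((Im1 a)\<^sup>2 + (Im2 a)\<^sup>2 + (Im3 a)\<^sup>2)"
    using assms by (simp add: r_def norm_quat_def inner_quat_def power2_eq_square)
  have "sqrt ((t * Im1 a)\<^sup>2 + (t * Im2 a)\<^sup>2 + (t * Im3 a)\<^sup>2)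
      = sqrt (t\<^sup>2 * ((Im1 a)\<^sup>2 + (Im2 a)\<^sup>2 + (Im3 a)\<^sup>2))"
    by (simp add: power_mult_distrib algebra_simps)
  then have s: "sqrt ((t * Im1 a)\<^sup>2 + (t * Im2 a)\<^sup>2 + (t * Im3 a)\<^sup>2) = \<bar>t\<bar> * r"
    by (simp only: real_sqrt_mult r real_sqrt_abs)
  have "quat_exp (t *\<^sub>R a) = of_real (cos (t * r)) + (sin (t * r) / r) *\<^sub>R a"
  proof (cases "t = 0 \<or> r = 0")
    case True
    then show ?thesis
      unfolding quat_exp_def by (auto simp: s Let_def)
  next
    case False
    then have "(t * Im1 a)\<^sup>2 + (t * Im2 a)\<^sup>2 + (t * Im3 a)\<^sup>2 \<noteq> 0"
      using s by auto
    \<comment> \<open>The norm seen by \<open>quat_exp\<close> is \<open>\<bar>t\<bar> * r\<close>;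
      the sign of \<open>t\<close> cancels because the cosine is even and the sine odd.\<close>
    with False show ?thesis
      using assms unfolding quat_exp_def
      by (simp add: s Let_def quat_eq_iff abs_if)
  qed
  then show ?thesis by (simp add: r_def)
qed

lemma quat_exp_scaleR_commute:
  assumes "Re a = 0"
  shows "quat_exp (t *\<^sub>R a) * a = a * quat_exp (t *\<^sub>R a)"
  by (simp add: quat_exp_scaleR[OF assms] algebra_simps of_real_def)

lemma norm_quat_exp_scaleR:
  assumes "Re a = 0"
  shows "norm (quat_exp (t *\<^sub>R a)) = 1"
proof (cases "a = 0")
  case True
  then show ?thesis by (simp add: quat_exp_def)
next
  case False
  define s where "s = sin (t * norm a) / norm a"
  have "quat_exp (t *\<^sub>R a) \<bullet> quat_exp (t *\<^sub>R a) = (cos (t * norm a))\<^sup>2 + s\<^sup>2 * (norm a)\<^sup>2"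
    using assms unfolding quat_exp_scaleR[OF assms] s_def[symmetric] power2_norm_eq_inner
    by (simp add: inner_quat_def power2_eq_square algebra_simps)
  also have "\<dots> = 1"
    using False by (simp add: s_def power_divide)
  finally show ?thesis by (simp add: norm_eq_1)
qed

text \<open>By \<open>imaginary_square\<close>, 1 and a nonzero \<open>a\<close> span a copy of the
  complex plane, where this is the usual derivative of the exponential.\<close>

lemma quat_exp_scaleR_has_vector_derivative:
  assumes "Re a = 0"
  shows "((\<lambda>t. quat_exp (t *\<^sub>R a)) has_vector_derivative a * quat_exp (t *\<^sub>R a)) (at t within T)"
proof (cases "a = 0")
  case True
  then show ?thesis by (simp add: quat_exp_def)
next
  case False
  define r where "r = norm a"
  have r: "r \<noteq> 0" using False by (simp add: r_def)
  have "((\<lambda>t. cos (t * r) *\<^sub>R (1::quat) + (sin (t * r) / r) *\<^sub>R a) has_vector_derivative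
      (- r * sin (t * r)) *\<^sub>R 1 + cos (t * r) *\<^sub>R a) (at t within T)"
    using r by (auto intro!: derivative_eq_intros)
  moreover have "(- r * sin (t * r)) *\<^sub>R 1 + cos (t * r) *\<^sub>R a
      = a * (cos (t * r) *\<^sub>R 1 + (sin (t * r) / r) *\<^sub>R a)"
    using r imaginary_square[OF assms, folded r_def]
    by (simp add: distrib_left of_real_def power2_eq_square)
  ultimately show ?thesis
    by (simp add: quat_exp_scaleR[OF assms] of_real_def r_def)
qed

section \<open>The normal Hamiltonian\<close>

text \<open>This eliminates the frame from the Hamiltonian.\<close>

lemma orthonormal_parseval:
  fixes f :: "nat \<Rightarrow> 'a :: real_inner"
  assumes on: "\<And>i j. i < N \<Longrightarrow> j < N \<Longrightarrow> f i \<bullet> f j = (if i = j then 1 else 0)"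
    and x: "x \<in> span (f ` {..<N})"
  shows "(\<Sum>i<N. (x \<bullet> f i)\<^sup>2) = x \<bullet> x"
proof -
  \<comment> \<open>The vectors equal to their own expansion form a subspace containing every
    \<open>f k\<close>.\<close>
  have "x = (\<Sum>i<N. (x \<bullet> f i) *\<^sub>R f i)"
    using x
  proof (induction rule: span_induct_alt)
    case base
    then show ?case by simp
  next
    case (step c b y)
    then obtain k where k: "k < N" "b = f k" by auto
    have "(\<Sum>i<N. (b \<bullet> f i) *\<^sub>R f i) = (\<Sum>i<N. if i = k then f i else 0)"
      using k on by (intro sum.cong) auto
    then have "b = (\<Sum>i<N. (b \<bullet> f i) *\<^sub>R f i)"
      using k by (simp add: sum.delta)
    then show ?case
      using step.IH
      by (simp add: inner_add_left scaleR_add_left sum.distrib flip: scaleR_scaleR scaleR_sum_right)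
  qed
  then have "x \<bullet> x = x \<bullet> (\<Sum>i<N. (x \<bullet> f i) *\<^sub>R f i)" by metis
  then show ?thesis by (simp add: inner_sum_right power2_eq_square)
qed

text \<open>Riesz representation: covectors are handled as vectors \<xi>.\<close>

lemma blinfun_apply_eq_inner:
  fixes l :: "'a :: euclidean_space \<Rightarrow>\<^sub>L real"
  shows "blinfun_apply l x = (\<Sum>b\<in>Basis. blinfun_apply l b *\<^sub>R b) \<bullet> x"
proof -
  have "blinfun_apply l x = blinfun_apply l (\<Sum>b\<in>Basis. (x \<bullet> b) *\<^sub>R b)"
    by (simp add: euclidean_representation)
  then show ?thesis
    by (simp add: blinfun.sum_right blinfun.scaleR_right inner_sum_left inner_commute[of x] mult.commute)
qed

text \<open>The sum over \<open>Basis\<close> is the squared norm of the Riesz vector. As a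
  polynomial on the whole ambient space the formula can be differentiated by the ordinary rules,
  while a frame carries no regularity.\<close>

definition ambient_hamiltonian :: "(quat ^ 'm) \<times> ((quat ^ 'm) \<Rightarrow>\<^sub>L real) \<Rightarrow> real" where
  "ambient_hamiltonian = (\<lambda>(q, l). 1 / 2 * ((\<Sum>b\<in>Basis. (blinfun_apply l b)\<^sup>2)
     - (blinfun_apply l (V1 q))\<^sup>2 - (blinfun_apply l (V2 q))\<^sup>2 - (blinfun_apply l (V3 q))\<^sup>2))"

lemma hamiltonian_eq_ambient:
  assumes X: "local_frame U N X" and ql: "(q, l) \<in> cotangent_over U"
  shows "hamiltonian N X (q, l) = ambient_hamiltonian (q, l)"
proof -
  have q: "q \<in> U" "q \<in> sphere 0 1" "blinfun_apply l q = 0"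
    using ql by (auto simp: cotangent_over_def)
  note on = frame_vectors_orthonormal[OF q(2)]
  define \<xi> where "\<xi> = (\<Sum>b\<in>Basis. blinfun_apply l b *\<^sub>R b)"
  have l: "blinfun_apply l x = \<xi> \<bullet> x" for x
    unfolding \<xi>_def by (rule blinfun_apply_eq_inner)
  \<comment> \<open>The horizontal part of \<xi>. It represents \<open>l\<close> on every frame
    vector, so Parseval and Pythagoras give the formula.\<close>
  define x where "x = \<xi> - q \<odot> A_quat q \<xi>"
  have "q \<bullet> \<xi> = 0" using q(3) by (simp add: l inner_commute)
  then have "hprod q x = 0"
    unfolding quat_eq_iff hprod_sel x_def rmult_A_quat using on
    by (simp add: inner_diff_left inner_diff_right inner_add_left inner_add_right inner_commute)
  then have x: "x \<in> horizontal_space q" by (simp add: horizontal_space_iff)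
  have X': "\<And>i j. i < N \<Longrightarrow> j < N \<Longrightarrow> X i q \<bullet> X j q = (if i = j then 1 else 0)"
    "span ((\<lambda>i. X i q) ` {..<N}) = horizontal_space q"
    using X q(1) by (auto simp: local_frame_def)
  have "l (X i q) = x \<bullet> X i q" if "i < N" for i
  proof -
    have "X i q \<in> horizontal_space q"
      using X'(2) that span_base[of "X i q" "(\<lambda>i. X i q) ` {..<N}"] by auto
    then have "X i q \<bullet> V1 q = 0" "X i q \<bullet> V2 q = 0" "X i q \<bullet> V3 q = 0"
      by (simp_all add: horizontal_space_iff quat_eq_iff hprod_sel)
    then show ?thesis
      by (simp add: l x_def rmult_A_quat inner_diff_left inner_add_left inner_commute[of _ "X i q"]
          inner_diff_right inner_add_right)
  qed
  then have "(\<Sum>i<N. (blinfun_apply l (X i q))\<^sup>2) = x \<bullet> x"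
    using orthonormal_parseval[of N "\<lambda>i. X i q" x] X' x by simp
  also have "\<dots> = \<xi> \<bullet> \<xi> - (\<xi> \<bullet> V1 q)\<^sup>2 - (\<xi> \<bullet> V2 q)\<^sup>2 - (\<xi> \<bullet> V3 q)\<^sup>2"
    unfolding x_def rmult_A_quat using on
    by (simp add: inner_diff_left inner_diff_right inner_add_left inner_add_right
        inner_commute[of "V1 q" \<xi>] inner_commute[of "V2 q" \<xi>] inner_commute[of "V3 q" \<xi>]
        inner_commute[of "V2 q" "V1 q"] inner_commute[of "V3 q" "V1 q"]
        inner_commute[of "V3 q" "V2 q"] power2_eq_square)
  also have "\<xi> \<bullet> \<xi> = (\<Sum>b\<in>Basis. (blinfun_apply l b)\<^sup>2)"
    by (simp add: l euclidean_inner[of \<xi> \<xi>] power2_eq_square)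
  finally show ?thesis by (simp add: hamiltonian_def ambient_hamiltonian_def l)
qed

lemma bounded_linear_V: "bounded_linear V1" "bounded_linear V2" "bounded_linear V3"
  unfolding V1_def V2_def V3_def by (rule rmult.bounded_linear_left)+

lemma ambient_hamiltonian_has_derivative:
  "(ambient_hamiltonian has_derivative
     (\<lambda>(w, m). blinfun_apply m (\<xi> - q \<odot> A_quat q \<xi>) + (\<xi> \<odot> A_quat q \<xi>) \<bullet> w))
   (at (q, blinfun_inner_right \<xi>) within S)"
proof -
  note V = bounded_linear_V[THEN bounded_linear.has_derivative]
  let ?l = "blinfun_inner_right \<xi>"
  have D: "(ambient_hamiltonian has_derivative
     (\<lambda>(w, m). 1 / 2 * ((\<Sum>b\<in>Basis. 2 * (\<xi> \<bullet> b * blinfun_apply m b))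
        - 2 * (\<xi> \<bullet> V1 q) * (blinfun_apply m (V1 q) + \<xi> \<bullet> V1 w)
        - 2 * (\<xi> \<bullet> V2 q) * (blinfun_apply m (V2 q) + \<xi> \<bullet> V2 w)
        - 2 * (\<xi> \<bullet> V3 q) * (blinfun_apply m (V3 q) + \<xi> \<bullet> V3 w))))
     (at (q, ?l) within S)"
    unfolding ambient_hamiltonian_def case_prod_unfold
    by (auto intro!: derivative_eq_intros V simp: fun_eq_iff field_simps)
  \<comment> \<open>Expanding \<xi> in the basis collapses the fibre terms; next, moving
    \<open>V1\<close>, \<open>V2\<close>, \<open>V3\<close> from \<open>w\<close> to \<xi> by
    skewness turns the base terms into one gradient.\<close>
  have contract: "(\<Sum>b\<in>Basis. 2 * (\<xi> \<bullet> b * blinfun_apply m b)) = 2 * blinfun_apply m \<xi>" for m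
    by (subst (2) blinfun_apply_eq_inner)
      (simp add: inner_sum_left inner_commute[of \<xi>] mult.commute flip: sum_distrib_left)
  have skew: "(\<xi> \<odot> A_quat q \<xi>) \<bullet> w =
      - ((\<xi> \<bullet> V1 q) * (\<xi> \<bullet> V1 w) + (\<xi> \<bullet> V2 q) * (\<xi> \<bullet> V2 w) + (\<xi> \<bullet> V3 q) * (\<xi> \<bullet> V3 w))" for w
    by (subst inner_rmult_imaginary)
      (simp_all add: A_quat_def[of q] rmult_A_quat[of w, unfolded A_quat_def] inner_add_right)
  from D[unfolded contract] show ?thesis
    by (simp add: skew rmult_A_quat[of q] blinfun.diff_right blinfun.add_right blinfun.scaleR_right
        algebra_simps)
qed

text \<open>Pairing with vectors tangent to the bundle fixes the momentum component only up to a
  multiple of \<open>q\<close>, since \<open>q \<bullet> w = 0\<close>. The coefficient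
  \<open>- (norm \<xi>)^2\<close> is forced by the linearized constraint that the covector kills
  \<open>q\<close>.\<close>

lemma hamiltonian_vector_normal:
  assumes X: "local_frame U N X" and q: "q \<in> U" "q \<in> sphere 0 1" and \<xi>: "q \<bullet> \<xi> = 0"
  shows "hamiltonian_vector U (hamiltonian N X) (q, blinfun_inner_right \<xi>)
    (\<xi> - q \<odot> A_quat q \<xi>,
     blinfun_inner_right (- (\<xi> \<odot> A_quat q \<xi>) - (norm \<xi>)\<^sup>2 *\<^sub>R q))"
proof -
  let ?a = "A_quat q \<xi>"
  have qq: "q \<bullet> q = 1" using q(2) by (simp add: norm_eq_1)
  have skew: "(x \<odot> ?a) \<bullet> y = - (x \<bullet> (y \<odot> ?a))" for x y :: "quat ^ 'm"
    by (rule inner_rmult_imaginary) (simp add: A_quat_def)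
  have mem: "(q, blinfun_inner_right \<xi>) \<in> cotangent_over U"
    using q \<xi> by (simp add: cotangent_over_def inner_commute)
  have "q \<bullet> (q \<odot> ?a) = 0"
    using skew[of q q] by (simp add: inner_commute)
  then have tangent: "(\<xi> - q \<odot> ?a, blinfun_inner_right (- (\<xi> \<odot> ?a) - (norm \<xi>)\<^sup>2 *\<^sub>R q))
      \<in> tangent_cotangent (q, blinfun_inner_right \<xi>)"
    using \<xi> qq skew[of \<xi> q]
    by (simp add: tangent_cotangent_def inner_diff_left inner_diff_right power2_norm_eq_inner)
  \<comment> \<open>The derivative within the cotangent bundle sees only values there, where both
    Hamiltonians agree.\<close>
  have deriv: "(hamiltonian N X has_derivative
      (\<lambda>(w, m). blinfun_apply m (\<xi> - q \<odot> ?a) + (\<xi> \<odot> ?a) \<bullet> w))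
      (at (q, blinfun_inner_right \<xi>) within cotangent_over U)"
    by (rule has_derivative_transform[OF mem _ ambient_hamiltonian_has_derivative])
      (auto simp: hamiltonian_eq_ambient[OF X])
  show ?thesis
    unfolding hamiltonian_vector_def
  proof (intro conjI exI ballI)
    fix W assume "W \<in> tangent_cotangent (q, blinfun_inner_right \<xi>)"
    then show "(\<lambda>(w, m). blinfun_apply m (\<xi> - q \<odot> ?a) + (\<xi> \<odot> ?a) \<bullet> w) W =
        canonical_form (\<xi> - q \<odot> ?a, blinfun_inner_right (- (\<xi> \<odot> ?a) - (norm \<xi>)\<^sup>2 *\<^sub>R q)) W"
      by (auto simp: tangent_cotangent_def canonical_form_def inner_diff_left)
  qed (fact tangent deriv)+
qed

section \<open>Twisted great circles\<close>

definition great_circle_velocity_at :: "quat ^ 'm \<Rightarrow> quat ^ 'm \<Rightarrow> real \<Rightarrow> quat ^ 'm" where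
  "great_circle_velocity_at p v t =
     cos (norm v * t) *\<^sub>R v - (norm v * sin (norm v * t)) *\<^sub>R p"

text \<open>At \<open>v = 0\<close> the quotient is \<open>0 / 0 = 0\<close>, so one formula covers
  both cases of the definition.\<close>

lemma great_circle_eq:
  "great_circle p v t = cos (norm v * t) *\<^sub>R p + (sin (norm v * t) / norm v) *\<^sub>R v"
  by (simp add: great_circle_def divide_inverse)

lemma great_circle_has_vector_derivative:
  "(great_circle p v has_vector_derivative great_circle_velocity_at p v t) (at t)"
proof -
  have "((\<lambda>t. cos (norm v * t) *\<^sub>R p + (sin (norm v * t) / norm v) *\<^sub>R v)
      has_vector_derivative great_circle_velocity_at p v t) (at t)"
    unfolding great_circle_velocity_at_def
    by (cases "v = 0") (auto intro!: derivative_eq_intros)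
  then show ?thesis by (simp add: great_circle_eq[abs_def])
qed

lemma great_circle_velocity_at_has_vector_derivative:
  "(great_circle_velocity_at p v has_vector_derivative - ((norm v)\<^sup>2 *\<^sub>R great_circle p v t)) (at t)"
proof -
  have "(great_circle_velocity_at p v has_vector_derivative
      - (norm v * sin (norm v * t)) *\<^sub>R v - (norm v * (norm v * cos (norm v * t))) *\<^sub>R p) (at t)"
    unfolding great_circle_velocity_at_def[abs_def]
    by (auto intro!: derivative_eq_intros simp: algebra_simps)
  then show ?thesis
    by (cases "v = 0") (simp_all add: great_circle_eq power2_eq_square algebra_simps)
qed

context
  fixes p v :: "quat ^ 'm"
  assumes p: "p \<in> sphere 0 1" and v: "v \<in> tangent_space p"
begin

lemma norm_great_circle_velocity_at: "norm (great_circle_velocity_at p v t) = norm v"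
proof -
  have "p \<bullet> p = 1" "p \<bullet> v = 0" "v \<bullet> p = 0"
    using p v by (simp_all add: norm_eq_1 tangent_space_def inner_commute)
  then have "(norm (C *\<^sub>R v - (norm v * S) *\<^sub>R p))\<^sup>2 = (norm v)\<^sup>2 * (C\<^sup>2 + S\<^sup>2)" for C S
    by (subst power2_norm_eq_inner) (simp add: inner_diff_left inner_diff_right
        dot_square_norm[of v] power2_eq_square algebra_simps)
  then have "(norm (great_circle_velocity_at p v t))\<^sup>2 = (norm v)\<^sup>2"
    by (simp add: great_circle_velocity_at_def)
  then show ?thesis by simp
qed

text \<open>The terms in \<open>hprod p p\<close> and \<open>hprod v v\<close> cancel. Tangency
  gives \<open>hprod v p = - hprod p v\<close>, so the mixed terms add up with coefficient
  \<open>C^2 + S^2\<close>.\<close>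

lemma hprod_great_circle:
  "hprod (great_circle p v t) (great_circle_velocity_at p v t) = A_quat p v"
proof -
  define C S where "C = cos (norm v * t)" and "S = sin (norm v * t)"
  have CS: "C\<^sup>2 + S\<^sup>2 = 1" by (simp add: C_def S_def)
  have pp: "hprod p p = 1" using p by (simp add: hprod_self)
  have "hprod v p = - hprod p v"
    using v by (subst hprod_commute) (simp add: quat_eq_iff hprod_sel tangent_space_def)
  then have "hprod (C *\<^sub>R p + (S / norm v) *\<^sub>R v) (C *\<^sub>R v - (norm v * S) *\<^sub>R p)
      = (C\<^sup>2 + S\<^sup>2) *\<^sub>R hprod p v"
    by (cases "v = 0")
      (simp_all add: hprod.add_left hprod.diff_right hprod.scaleR_left hprod.scaleR_right pp
        hprod_self[of v] hprod.zero_left hprod.zero_right of_real_def algebra_simps power2_eq_square)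
  then show ?thesis
    unfolding great_circle_eq great_circle_velocity_at_def A_quat_eq_hprod[OF v]
    using CS by (simp add: C_def S_def)
qed

definition rot :: "real \<Rightarrow> quat" where
  "rot t = quat_exp (- (t *\<^sub>R A_quat p v))"

lemma Re_A_quat [simp]: "Re (A_quat p v) = 0"
  by (simp add: A_quat_def)

lemma rot_eq: "rot t = quat_exp (t *\<^sub>R (- A_quat p v))"
  by (simp add: rot_def)

lemma norm_rot: "norm (rot t) = 1"
  unfolding rot_eq by (rule norm_quat_exp_scaleR) simp

lemma rot_commute: "rot t * A_quat p v = A_quat p v * rot t"
  using quat_exp_scaleR_commute[of "- A_quat p v" t] by (simp add: rot_eq)

lemma cnj_rot: "quat_cnj (rot t) * rot t = 1"
proof -
  have "quat_cnj (rot t) * rot t = of_real ((norm (rot t))\<^sup>2)"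
    by (simp add: quat_eq_iff power2_norm_eq_inner inner_quat_def)
  then show ?thesis by (simp add: norm_rot)
qed

text \<open>\<open>A_quat p v\<close> commutes with \<open>rot t\<close> and so can act last, at the
  twisted point. The curve is arbitrary because both the circle and its velocity get
  twisted.\<close>

lemma rmult_rot_has_vector_derivative:
  assumes "(c has_vector_derivative c') (at t)"
  shows "((\<lambda>t. c t \<odot> rot t) has_vector_derivative
    c' \<odot> rot t - c t \<odot> rot t \<odot> A_quat p v) (at t)"
proof -
  have "(rot has_vector_derivative - A_quat p v * rot t) (at t)"
    unfolding rot_eq[abs_def] by (rule quat_exp_scaleR_has_vector_derivative) simp
  from rmult.has_vector_derivative[OF assms this] show ?thesis
    by (simp add: rmult_rmult rot_commute rmult.minus_right)
qed

text \<open>The twist conjugates the constant \<open>A_quat p v\<close> by \<open>rot t\<close>,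
  which commutes with it.\<close>

lemma hprod_twisted:
  "hprod (great_circle p v t \<odot> rot t) (great_circle_velocity_at p v t \<odot> rot t) = A_quat p v"
  unfolding hprod_rmult hprod_great_circle
  by (simp add: mult.assoc flip: rot_commute) (simp add: cnj_rot flip: mult.assoc)

lemma twisted_in_sphere: "great_circle p v t \<odot> rot t \<in> sphere 0 1"
  using great_circle_sphere[OF p v] by (simp add: norm_rmult norm_rot)

lemma horizontal_lift_twisted:
  "horizontal_lift (\<lambda>t. hopf (great_circle p v t)) (\<lambda>t. great_circle p v t \<odot> rot t)"
proof -
  \<comment> \<open>At a unit vector \<open>q\<close>, \<open>hprod q (q \<odot> A)\<close> is
    \<open>A\<close>, which is exactly the value of the twisted velocity.\<close>
  have "hprod (great_circle p v t \<odot> rot t)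
      (great_circle_velocity_at p v t \<odot> rot t - great_circle p v t \<odot> rot t \<odot> A_quat p v) = 0" for t
    using twisted_in_sphere[of t]
    by (simp add: hprod.diff_right hprod_twisted hprod_rmult_right[of _ "_ \<odot> rot t"] hprod_self)
  moreover have "hopf (great_circle p v t \<odot> rot t) = hopf (great_circle p v t)" for t
    using hopf_eq_iff[OF great_circle_sphere[OF p v, of t] twisted_in_sphere[of t]] norm_rot by auto
  ultimately show ?thesis
    unfolding horizontal_lift_def horizontal_curve_def horizontal_space_iff
    using twisted_in_sphere
      rmult_rot_has_vector_derivative[OF great_circle_has_vector_derivative[of p v]]
    by blast
qed

text \<open>
  With the covector \<open>\<xi> = c' \<odot> rot\<close> over \<open>q = c \<odot> rot\<close> one has \<open>hprod q \<xi> = A\<close>, so Hamilton's equations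
  \<open>q' = \<xi> - q \<odot> hprod q \<xi>\<close> and \<open>\<xi>' = - \<xi> \<odot> hprod q \<xi> - \<bar>\<xi>\<bar>\<^sup>2 q\<close> reduce to \<open>c'' = - \<bar>v\<bar>\<^sup>2 c\<close>.
\<close>

lemma normal_geodesic_twisted: "normal_geodesic (\<lambda>t. great_circle p v t \<odot> rot t)"
proof -
  define q where "q t = great_circle p v t \<odot> rot t" for t
  define \<xi> where "\<xi> t = great_circle_velocity_at p v t \<odot> rot t" for t
  have orth: "q t \<bullet> \<xi> t = 0" for t
    using hprod_twisted[of t] by (simp add: q_def \<xi>_def flip: hprod_sel(1))
  \<comment> \<open>The vertical part of the covector is conserved, so the coefficients in
    Hamilton's equations are constant.\<close>
  have A: "A_quat (q t) (\<xi> t) = A_quat p v" for t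
    using A_quat_eq_hprod[of "\<xi> t" "q t"] orth hprod_twisted[of t]
    by (simp add: tangent_space_def q_def \<xi>_def)
  have norm_\<xi>: "norm (\<xi> t) = norm v" for t
    by (simp add: \<xi>_def norm_rmult norm_rot norm_great_circle_velocity_at)
  have sphere: "q t \<in> sphere 0 1" for t
    unfolding q_def by (rule twisted_in_sphere)
  have dq: "(q has_vector_derivative \<xi> t - q t \<odot> A_quat p v) (at t)" for t
    unfolding q_def[abs_def] \<xi>_def
    by (rule rmult_rot_has_vector_derivative[OF great_circle_has_vector_derivative])
  have d\<xi>: "(\<xi> has_vector_derivative - (\<xi> t \<odot> A_quat p v) - (norm v)\<^sup>2 *\<^sub>R q t) (at t)" for t
    using rmult_rot_has_vector_derivative[OF great_circle_velocity_at_has_vector_derivative[of p v t]]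
    by (simp add: q_def \<xi>_def[abs_def] rmult.minus_left rmult.scaleR_left minus_diff_commute)
  have "hamiltonian_solution (\<lambda>t. (q t, blinfun_inner_right (\<xi> t)))"
    unfolding hamiltonian_solution_def
  proof (intro conjI allI exI impI)
    fix t
    show "(q t, blinfun_inner_right (\<xi> t)) \<in> cotangent_over (sphere 0 1)"
      using sphere orth by (simp add: cotangent_over_def inner_commute)
    show "((\<lambda>t. (q t, blinfun_inner_right (\<xi> t))) has_vector_derivative
        (\<xi> t - q t \<odot> A_quat p v,
         blinfun_inner_right (- (\<xi> t \<odot> A_quat p v) - (norm v)\<^sup>2 *\<^sub>R q t))) (at t)"
      by (intro has_vector_derivative_Pair dq
          bounded_linear.has_vector_derivative[OF bounded_linear_blinfun_inner_right] d\<xi>)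
    fix U N X
    assume "local_frame U N X \<and> fst (q t, blinfun_inner_right (\<xi> t)) \<in> U"
    then show "hamiltonian_vector U (hamiltonian N X) (q t, blinfun_inner_right (\<xi> t))
        (\<xi> t - q t \<odot> A_quat p v,
         blinfun_inner_right (- (\<xi> t \<odot> A_quat p v) - (norm v)\<^sup>2 *\<^sub>R q t))"
      using hamiltonian_vector_normal[of U N X "q t" "\<xi> t"] sphere orth
      by (simp add: A norm_\<xi>)
  qed
  then show ?thesis
    unfolding normal_geodesic_def q_def by auto
qed

end

section \<open>Uniqueness of horizontal lifts\<close>

lemma horizontal_lift_unique:
  assumes \<gamma>: "horizontal_lift b \<gamma>" and \<delta>: "horizontal_lift b \<delta>" and eq: "\<delta> 0 = \<gamma> 0"
  shows "\<delta> = \<gamma>"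
proof -
  have sphere: "\<gamma> t \<in> sphere 0 1" "\<delta> t \<in> sphere 0 1" for t
    using \<gamma> \<delta> by (auto simp: horizontal_lift_def horizontal_curve_def)
  have \<gamma>\<gamma>: "hprod (\<gamma> t) (\<gamma> t) = 1" for t
    using sphere(1)[of t] by (simp add: hprod_self)
  have fibre: "\<exists>u. \<delta> t = \<gamma> t \<odot> u" "\<exists>u. \<gamma> t = \<delta> t \<odot> u" for t
  proof -
    have "hopf (\<gamma> t) = hopf (\<delta> t)"
      using \<gamma> \<delta> by (simp add: horizontal_lift_def)
    then show "\<exists>u. \<delta> t = \<gamma> t \<odot> u" "\<exists>u. \<gamma> t = \<delta> t \<odot> u"
      using hopf_eq_iff sphere by metis+
  qed
  \<comment> \<open>A vector horizontal at one point has zero \<open>hprod\<close> with the whole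
    fibre through it, so both terms of the product rule vanish.\<close>
  have "((\<lambda>t. hprod (\<gamma> t) (\<delta> t)) has_vector_derivative 0) (at t)" for t
  proof -
    obtain \<gamma>' \<delta>' where d: "(\<gamma> has_vector_derivative \<gamma>') (at t)" "(\<delta> has_vector_derivative \<delta>') (at t)"
      and h: "hprod (\<gamma> t) \<gamma>' = 0" "hprod (\<delta> t) \<delta>' = 0"
      using \<gamma> \<delta> unfolding horizontal_lift_def horizontal_curve_def horizontal_space_iff by metis
    obtain u where "\<delta> t = \<gamma> t \<odot> u" using fibre by blast
    moreover have "hprod \<gamma>' (\<gamma> t) = 0"
      using h(1) by (subst hprod_commute) (simp add: quat_eq_iff)
    ultimately have "hprod \<gamma>' (\<delta> t) = 0"
      by (simp add: hprod_rmult_right)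
    moreover obtain u' where "\<gamma> t = \<delta> t \<odot> u'" using fibre by blast
    then have "hprod (\<gamma> t) \<delta>' = 0"
      using h(2) by (simp add: hprod_rmult_left)
    ultimately show ?thesis
      using hprod.has_vector_derivative[OF d] by simp
  qed
  then obtain c where c: "\<And>t. hprod (\<gamma> t) (\<delta> t) = c"
    using has_vector_derivative_zero_constant[of UNIV "\<lambda>t. hprod (\<gamma> t) (\<delta> t)"] by auto
  then have "c = 1" using eq \<gamma>\<gamma> by metis
  show ?thesis
  proof
    fix t
    \<comment> \<open>The factor is recovered as \<open>u = hprod (\<gamma> t) (\<delta> t)\<close>,
      which keeps its initial value 1.\<close>
    obtain u where u: "\<delta> t = \<gamma> t \<odot> u" using fibre by blast
    then have "u = 1"
      using c[of t] \<open>c = 1\<close> by (simp add: hprod_rmult_right \<gamma>\<gamma>)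
    then show "\<delta> t = \<gamma> t" using u by simp
  qed
qed

theorem corollary2:
  fixes n :: nat and p v :: "quat ^ 'm" and \<gamma> :: "real \<Rightarrow> quat ^ 'm"
  assumes "n \<ge> 1" and "CARD('m) = n + 1"
    and "p \<in> sphere 0 1" and "v \<in> tangent_space p"
    and "\<gamma> = (\<lambda>t. \<chi> l. great_circle p v t $ l * quat_exp (- (t *\<^sub>R A_quat p v)))"
  shows "horizontal_lift (\<lambda>t. hopf (great_circle p v t)) \<gamma> \<and> \<gamma> 0 = p \<and>
    (\<forall>\<delta>. horizontal_lift (\<lambda>t. hopf (great_circle p v t)) \<delta> \<and> \<delta> 0 = p \<longrightarrow> \<delta> = \<gamma>) \<and>
    normal_geodesic \<gamma>"
proof -
  have \<gamma>: "\<gamma> = (\<lambda>t. great_circle p v t \<odot> rot p v t)"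
    unfolding assms(5) rmult_def rot_def[OF assms(3,4)] ..
  have lift: "horizontal_lift (\<lambda>t. hopf (great_circle p v t)) \<gamma>"
    unfolding \<gamma> by (rule horizontal_lift_twisted[OF assms(3,4)])
  have start: "\<gamma> 0 = p"
    by (simp add: assms(5) quat_exp_def)
  have normal: "normal_geodesic \<gamma>"
    unfolding \<gamma> by (rule normal_geodesic_twisted[OF assms(3,4)])
  have "\<delta> = \<gamma>" if "horizontal_lift (\<lambda>t. hopf (great_circle p v t)) \<delta> \<and> \<delta> 0 = p" for \<delta>
    using horizontal_lift_unique[OF lift, of \<delta>] that start by simp
  with lift start normal show ?thesis by blast
qed

end
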